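(* There exists a countable abelian group $G$ with a subgroup $H$ having the following properties: (a) $G$ does not admit a minimally almost periodic Hausdorff group topology; (b) $G/H\cong H$, and both $H$ and $G/H$ admit minimally almost periodic Hausdorff group topologies; (c) there does not exist any Hausdorff group topology $\tau$ on $G$ such that both $H$ and $G/H$, equipped with the topology induced by $\tau$ and the quotient topology of $\tau$ respectively, are simultaneously minimally almost periodic.
   Context: A character of a topological abelian group is a continuous homomorphism into the circle group $\mathbb{T}=\mathbb{R}/\mathbb{Z}$; a topological abelian group is minimally almost periodic if all its characters are trivial. *)

theory Defs
  imports "HOL-Analysis.Analysis" "HOL-Algebra.Coset"
begin

text \<open>The finest topology on \<open>f ` topspace X\<close> that makes \<open>f\<close> continuous.\<close>

definition quotient_topology :: "'a topology \<Rightarrow> ('a \<Rightarrow> 'b) \<Rightarrow> 'b topology" where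
  "quotient_topology X f =
     topology (\<lambda>U. U \<subseteq> f ` topspace X \<and> openin X {x \<in> topspace X. f x \<in> U})"

lemma openin_quotient_topology:
  "openin (quotient_topology X f) U \<longleftrightarrow>
     U \<subseteq> f ` topspace X \<and> openin X {x \<in> topspace X. f x \<in> U}"
proof -
  have "istopology (\<lambda>U. U \<subseteq> f ` topspace X \<and> openin X {x \<in> topspace X. f x \<in> U})"
    unfolding istopology_def
  proof (intro conjI allI impI)
    fix S T
    assume S: "S \<subseteq> f ` topspace X \<and> openin X {x \<in> topspace X. f x \<in> S}"
      and T: "T \<subseteq> f ` topspace X \<and> openin X {x \<in> topspace X. f x \<in> T}"
    then show "S \<inter> T \<subseteq> f ` topspace X"
      by blast
    have "{x \<in> topspace X. f x \<in> S \<inter> T} =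
        {x \<in> topspace X. f x \<in> S} \<inter> {x \<in> topspace X. f x \<in> T}"
      by blast
    then show "openin X {x \<in> topspace X. f x \<in> S \<inter> T}"
      using S T by (simp only: openin_Int)
  next
    fix \<K>
    assume K: "\<forall>K\<in>\<K>. K \<subseteq> f ` topspace X \<and> openin X {x \<in> topspace X. f x \<in> K}"
    then show "\<Union>\<K> \<subseteq> f ` topspace X"
      by blast
    have "{x \<in> topspace X. f x \<in> \<Union>\<K>} = (\<Union>K\<in>\<K>. {x \<in> topspace X. f x \<in> K})"
      by blast
    with K show "openin X {x \<in> topspace X. f x \<in> \<Union>\<K>}"
      by auto
  qed
  then show ?thesis
    by (simp add: quotient_topology_def topology_inverse')
qed

lemma topspace_quotient_topology [simp]:
  "topspace (quotient_topology X f) = f ` topspace X"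
proof -
  have "{x \<in> topspace X. f x \<in> f ` topspace X} = topspace X"
    by blast
  then have "openin (quotient_topology X f) (f ` topspace X)"
    by (simp add: openin_quotient_topology)
  moreover have "topspace (quotient_topology X f) \<subseteq> f ` topspace X"
    using openin_topspace [of "quotient_topology X f"]
    unfolding openin_quotient_topology by (rule conjunct1)
  ultimately show ?thesis
    by (intro subset_antisym openin_subset)
qed

lemma quotient_map_quotient_topology: "quotient_map X (quotient_topology X f) f"
  by (auto simp: quotient_map_def openin_quotient_topology)

definition coset_topology ::
    "('a, 'b) monoid_scheme \<Rightarrow> 'a topology \<Rightarrow> 'a set \<Rightarrow> 'a set topology" where
  "coset_topology G \<tau> H = quotient_topology \<tau> (\<lambda>x. H #>\<^bsub>G\<^esub> x)"

definition group_topology :: "('a, 'b) monoid_scheme \<Rightarrow> 'a topology \<Rightarrow> bool" where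
  "group_topology G \<tau> \<longleftrightarrow>
     topspace \<tau> = carrier G \<and>
     continuous_map (prod_topology \<tau> \<tau>) \<tau> (\<lambda>(x, y). x \<otimes>\<^bsub>G\<^esub> y) \<and>
     continuous_map \<tau> \<tau> (\<lambda>x. inv\<^bsub>G\<^esub> x)"

definition real_group :: "real monoid" where
  "real_group = \<lparr>carrier = UNIV, mult = (+), one = 0\<rparr>"

text \<open>The circle group is \<open>\<real>/\<int>\<close>, so its elements are cosets of \<open>\<int>\<close>.\<close>

definition circle_group :: "real set monoid" where
  "circle_group = real_group Mod \<int>"

definition circle_topology :: "real set topology" where
  "circle_topology = coset_topology real_group euclideanreal \<int>"

definition characters ::
    "('a, 'b) monoid_scheme \<Rightarrow> 'a topology \<Rightarrow> ('a \<Rightarrow> real set) set" where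
  "characters G \<tau> = {h \<in> hom G circle_group. continuous_map \<tau> circle_topology h}"

text \<open>The Hausdorff property is not part of minimal almost periodicity.\<close>

definition minimally_almost_periodic ::
    "('a, 'b) monoid_scheme \<Rightarrow> 'a topology \<Rightarrow> bool" where
  "minimally_almost_periodic G \<tau> \<longleftrightarrow>
     group_topology G \<tau> \<and>
     (\<forall>h \<in> characters G \<tau>. \<forall>x \<in> carrier G. h x = \<one>\<^bsub>circle_group\<^esub>)"

definition admits_minimally_almost_periodic_Hausdorff :: "('a, 'b) monoid_scheme \<Rightarrow> bool" where
  "admits_minimally_almost_periodic_Hausdorff G \<longleftrightarrow>
     (\<exists>\<tau>. Hausdorff_space \<tau> \<and> minimally_almost_periodic G \<tau>)"

lemma comm_group_real_group: "comm_group real_group"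
proof (rule comm_groupI)
  fix x assume "x \<in> carrier real_group"
  show "\<exists>y\<in>carrier real_group. y \<otimes>\<^bsub>real_group\<^esub> x = \<one>\<^bsub>real_group\<^esub>"
    by (rule bexI [of _ "- x"]) (simp_all add: real_group_def)
qed (simp_all add: real_group_def)

lemma inv_real_group: "inv\<^bsub>real_group\<^esub> x = - x"
  by (rule group.inv_equality [OF comm_group.axioms(2) [OF comm_group_real_group]])
    (simp_all add: real_group_def)

lemma subgroup_Ints_real_group: "subgroup \<int> real_group"
  by (rule subgroup.intro)
    (simp_all only: inv_real_group, simp_all add: real_group_def)

lemma comm_group_circle_group: "comm_group circle_group"
  unfolding circle_group_def
  using comm_group.abelian_FactGroup [OF comm_group_real_group subgroup_Ints_real_group] .

end

theory Submission
  imports Defs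
begin

text \<open>Let \<open>B\<close> be the Boolean group of periodic sets of natural numbers under symmetric difference,
  normed by density. Every periodic set splits into residue classes of arbitrarily small density, so
  \<open>B\<close> has no proper open subgroup; as characters of a Boolean group have open kernels, \<open>B\<close> is
  minimally almost periodic. Let \<open>G\<close> be an extension of \<open>B\<close> by \<open>H = B\<close> in which \<open>2G\<close> has exactly two
  elements. In any Hausdorff group topology the kernel of doubling is then open of index two and
  gives a non-trivial character of \<open>G\<close>. If \<open>H\<close> and \<open>G/H\<close> were both minimally almost periodic, then so
  would be \<open>G\<close>, because a character of \<open>G\<close> that is trivial on \<open>H\<close> factors through \<open>G/H\<close>.\<close>

section \<open>The circle group and its element of order two\<close>

lemma r_coset_Ints_real_group: "\<int> #>\<^bsub>real_group\<^esub> x = {y. y - x \<in> \<int>}"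
proof (intro equalityI subsetI)
  fix y assume "y \<in> {y. y - x \<in> \<int>}"
  then show "y \<in> \<int> #>\<^bsub>real_group\<^esub> x"
    by (auto simp: r_coset_def real_group_def intro!: bexI [of _ "y - x"])
qed (auto simp: r_coset_def real_group_def)

lemma r_coset_Ints_eq_iff:
  "\<int> #>\<^bsub>real_group\<^esub> x = \<int> #>\<^bsub>real_group\<^esub> y \<longleftrightarrow> x - y \<in> \<int>"
proof
  assume "\<int> #>\<^bsub>real_group\<^esub> x = \<int> #>\<^bsub>real_group\<^esub> y"
  moreover have "x \<in> \<int> #>\<^bsub>real_group\<^esub> x"
    by (simp add: r_coset_Ints_real_group)
  ultimately have "x \<in> {z. z - y \<in> \<int>}"
    by (simp add: r_coset_Ints_real_group)
  then show "x - y \<in> \<int>" by simp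
next
  assume "x - y \<in> \<int>"
  then have "z - x \<in> \<int> \<longleftrightarrow> z - y \<in> \<int>" for z
    using Ints_add [of "z - x" "x - y"] Ints_diff [of "z - y" "x - y"] by auto
  then show "\<int> #>\<^bsub>real_group\<^esub> x = \<int> #>\<^bsub>real_group\<^esub> y"
    by (simp add: r_coset_Ints_real_group)
qed

lemma carrier_circle_group: "carrier circle_group = range (\<lambda>x. \<int> #>\<^bsub>real_group\<^esub> x)"
  by (auto simp: circle_group_def FactGroup_def RCOSETS_def real_group_def)

lemma one_circle_group: "\<one>\<^bsub>circle_group\<^esub> = \<int> #>\<^bsub>real_group\<^esub> 0"
  by (simp add: circle_group_def FactGroup_def r_coset_Ints_real_group)

lemma mult_circle_group:
  "(\<int> #>\<^bsub>real_group\<^esub> x) \<otimes>\<^bsub>circle_group\<^esub> (\<int> #>\<^bsub>real_group\<^esub> y) =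
   \<int> #>\<^bsub>real_group\<^esub> (x + y)"
proof -
  interpret R: comm_group real_group by (rule comm_group_real_group)
  interpret normal "\<int>" real_group
    by (rule R.subgroup_imp_normal [OF subgroup_Ints_real_group])
  show ?thesis
    using rcos_sum [of x y] by (simp add: circle_group_def FactGroup_def) (simp add: real_group_def)
qed

lemma topspace_circle_topology: "topspace circle_topology = carrier circle_group"
  by (simp add: circle_topology_def coset_topology_def carrier_circle_group)

text \<open>The element of order two of the circle, hence the only non-trivial value open to a
  character of a Boolean group.\<close>

definition half_turn :: "real set" where
  "half_turn = \<int> #>\<^bsub>real_group\<^esub> (1/2)"

lemma half_notin_Ints: "(1/2 :: real) \<notin> \<int>"
proof
  assume "(1/2 :: real) \<in> \<int>"
  then obtain n :: int where "1/2 = real_of_int n" by (auto elim: Ints_cases)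
  then have "1 = real_of_int (2 * n)" by simp
  then have "1 = 2 * n" by (metis of_int_1 of_int_eq_iff)
  then show False by presburger
qed

lemma half_turn_carrier: "half_turn \<in> carrier circle_group"
  by (auto simp: half_turn_def carrier_circle_group)

lemma half_turn_neq_one: "half_turn \<noteq> \<one>\<^bsub>circle_group\<^esub>"
  by (simp add: half_turn_def one_circle_group r_coset_Ints_eq_iff half_notin_Ints)

lemma half_turn_square: "half_turn \<otimes>\<^bsub>circle_group\<^esub> half_turn = \<one>\<^bsub>circle_group\<^esub>"
  by (simp add: half_turn_def one_circle_group mult_circle_group r_coset_Ints_eq_iff)

text \<open>If \<open>x + x\<close> is an integer \<open>n\<close>, the parity of \<open>n\<close>
  decides whether \<open>x\<close> is an integer or a half-integer.\<close>

lemma circle_group_involution: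
  assumes "c \<in> carrier circle_group" "c \<otimes>\<^bsub>circle_group\<^esub> c = \<one>\<^bsub>circle_group\<^esub>"
  shows "c = \<one>\<^bsub>circle_group\<^esub> \<or> c = half_turn"
proof -
  obtain x where x: "c = \<int> #>\<^bsub>real_group\<^esub> x"
    using assms(1) by (auto simp: carrier_circle_group)
  have "x + x \<in> \<int>"
    using assms(2) by (simp add: x mult_circle_group one_circle_group r_coset_Ints_eq_iff)
  then obtain n :: int where n: "x + x = real_of_int n" by (auto elim: Ints_cases)
  show ?thesis
  proof (cases "even n")
    case True
    then obtain k where "n = 2 * k" by blast
    then have "x = real_of_int k" using n by simp
    then show ?thesis by (simp add: x one_circle_group r_coset_Ints_eq_iff)
  next
    case False
    then obtain k where "n = 2 * k + 1" by (blast elim: oddE)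
    then have "x - 1/2 = real_of_int k" using n by simp
    then show ?thesis by (simp add: x half_turn_def r_coset_Ints_eq_iff)
  qed
qed

text \<open>The preimage in the reals is the complement of the closed set of half-integers. This
  neighbourhood of the identity meets the values of a character of a Boolean group only in the
  identity, so continuity yields an open kernel.\<close>

lemma openin_circle_topology_minus_half_turn:
  "openin circle_topology (carrier circle_group - {half_turn})"
proof -
  have "closed ((\<lambda>x::real. x - 1/2) -` \<int>)"
    by (intro continuous_closed_vimage closed_Ints continuous_intros)
  moreover have "{x. \<int> #>\<^bsub>real_group\<^esub> x \<in> carrier circle_group - {half_turn}} =
      - ((\<lambda>x::real. x - 1/2) -` \<int>)"
    by (auto simp: carrier_circle_group half_turn_def r_coset_Ints_eq_iff)
  ultimately show ?thesis
    by (auto simp: circle_topology_def coset_topology_def openin_quotient_topology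
        carrier_circle_group open_closed)
qed

section \<open>Obstruction, extension, existence and transport of topologies\<close>

text \<open>The point \<open>a\<close> is the only non-trivial square, so the elements of order at most two form a
  clopen subgroup of index two, and the quotient map onto it is a character.\<close>

lemma not_admits_if_single_square:
  fixes G (structure)
  assumes "comm_group G"
    and squares: "\<And>x. x \<in> carrier G \<Longrightarrow> x \<otimes> x \<in> {\<one>, a}"
    and g: "g \<in> carrier G" "g \<otimes> g \<noteq> \<one>"
  shows "\<not> admits_minimally_almost_periodic_Hausdorff G"
proof
  interpret comm_group G by fact
  interpret C: comm_group circle_group by (rule comm_group_circle_group)
  assume "admits_minimally_almost_periodic_Hausdorff G"
  then obtain \<tau> where haus: "Hausdorff_space \<tau>" and map: "minimally_almost_periodic G \<tau>"
    by (auto simp: admits_minimally_almost_periodic_Hausdorff_def)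
  have top: "topspace \<tau> = carrier G"
    and mult: "continuous_map (prod_topology \<tau> \<tau>) \<tau> (\<lambda>(x, y). x \<otimes> y)"
    using map by (auto simp: minimally_almost_periodic_def group_topology_def)
  have "continuous_map \<tau> (prod_topology \<tau> \<tau>) (\<lambda>x. (x, x))"
    by (simp add: continuous_map_pairedI)
  from continuous_map_compose [OF this mult]
  have sq: "continuous_map \<tau> \<tau> (\<lambda>x. x \<otimes> x)" by (simp add: o_def)
  \<comment> \<open>The square of \<open>g\<close> is non-trivial and lies in
    \<open>{\<one>, a}\<close>, so it is \<open>a\<close>.\<close>
  have a: "a = g \<otimes> g" "a \<noteq> \<one>" "a \<in> carrier G"
    using squares [OF g(1)] g by auto
  define h where "h x = (if x \<otimes> x = \<one> then \<one>\<^bsub>circle_group\<^esub> else half_turn)" for x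
  \<comment> \<open>Points are closed in a Hausdorff space, so the fibres of squaring are closed.
    There are only two of them, each the complement of the other, so both are also open.\<close>
  have cl: "closedin \<tau> {x \<in> topspace \<tau>. x \<otimes> x \<in> {c}}" if "c \<in> carrier G" for c
    using that haus top
    by (intro closedin_continuous_map_preimage [OF sq] closedin_Hausdorff_singleton) auto
  have compl: "{x \<in> topspace \<tau>. x \<otimes> x \<in> {\<one>}} = topspace \<tau> - {x \<in> topspace \<tau>. x \<otimes> x \<in> {a}}"
      "{x \<in> topspace \<tau>. x \<otimes> x \<in> {a}} = topspace \<tau> - {x \<in> topspace \<tau>. x \<otimes> x \<in> {\<one>}}"
    using squares a top by auto
  have op1: "openin \<tau> {x \<in> topspace \<tau>. x \<otimes> x \<in> {\<one>}}"
    unfolding compl(1) using cl [OF a(3)] by blast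
  have op2: "openin \<tau> {x \<in> topspace \<tau>. x \<otimes> x \<in> {a}}"
    unfolding compl(2) using cl [OF one_closed] by blast
  have "continuous_map \<tau> circle_topology h"
    unfolding continuous_map_def
  proof (intro conjI allI impI)
    show "h \<in> topspace \<tau> \<rightarrow> topspace circle_topology"
      by (auto simp: h_def topspace_circle_topology half_turn_carrier)
    fix U :: "real set set"
    \<comment> \<open>\<open>h\<close> is constant on each fibre of squaring, so the preimage of any
      set is a union of these open fibres.\<close>
    have "{x \<in> topspace \<tau>. h x \<in> U} =
        (if \<one>\<^bsub>circle_group\<^esub> \<in> U then {x \<in> topspace \<tau>. x \<otimes> x \<in> {\<one>}} else {}) \<union>
        (if half_turn \<in> U then {x \<in> topspace \<tau>. x \<otimes> x \<in> {a}} else {})"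
      using squares a(2) top by (auto simp: h_def)
    then show "openin \<tau> {x \<in> topspace \<tau>. h x \<in> U}"
      using op1 op2 by (simp add: openin_Un)
  qed
  moreover have "h \<in> hom G circle_group"
  proof (rule homI)
    fix x y assume xy: "x \<in> carrier G" "y \<in> carrier G"
    have aa: "a \<otimes> a = \<one>"
    proof (rule ccontr)
      assume "a \<otimes> a \<noteq> \<one>"
      then have "a \<otimes> a = a" using squares [OF a(3)] by auto
      then show False using a(2,3) by (metis l_cancel_one)
    qed
    have "(x \<otimes> y) \<otimes> (x \<otimes> y) = (x \<otimes> x) \<otimes> (y \<otimes> y)"
      using xy by (simp add: m_ac)
    then show "h (x \<otimes> y) = h x \<otimes>\<^bsub>circle_group\<^esub> h y"
      using squares [OF xy(1)] squares [OF xy(2)] a(2,3) aa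
      by (auto simp: h_def half_turn_square half_turn_carrier)
  qed (simp add: h_def half_turn_carrier)
  ultimately have "h g = \<one>\<^bsub>circle_group\<^esub>"
    using map g(1) by (auto simp: minimally_almost_periodic_def characters_def)
  then show False using g(2) half_turn_neq_one by (simp add: h_def)
qed

text \<open>This reduces (c) to (a): a topology forbidden by (c) would make \<open>G\<close> itself
  minimally almost periodic.\<close>

lemma minimally_almost_periodic_extension:
  fixes G (structure)
  assumes "comm_group G" "subgroup H G" and top: "group_topology G \<tau>"
    and H: "minimally_almost_periodic (G\<lparr>carrier := H\<rparr>) (subtopology \<tau> H)"
    and Q: "minimally_almost_periodic (G Mod H) (coset_topology G \<tau> H)"
  shows "minimally_almost_periodic G \<tau>"
  unfolding minimally_almost_periodic_def
proof (intro conjI top ballI)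
  interpret comm_group G by fact
  interpret H: subgroup H G by fact
  interpret C: comm_group circle_group by (rule comm_group_circle_group)
  fix h x assume h: "h \<in> characters G \<tau>" and x: "x \<in> carrier G"
  have hom: "h \<in> hom G circle_group" and cont: "continuous_map \<tau> circle_topology h"
    using h by (auto simp: characters_def)
  interpret h: group_hom G circle_group h
    by unfold_locales (rule hom)
  \<comment> \<open>The restriction of \<open>h\<close> is a character of \<open>H\<close> and
    therefore trivial, so \<open>h\<close> factors algebraically as a map \<open>k\<close> on the
    cosets.\<close>
  have "h \<in> characters (G\<lparr>carrier := H\<rparr>) (subtopology \<tau> H)"
    using hom H.subset continuous_map_from_subtopology [OF cont]
    by (auto simp: characters_def hom_def Pi_iff)
  then have "H \<subseteq> kernel G circle_group h"
    using H H.subset by (auto simp: minimally_almost_periodic_def kernel_def)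
  from h.FactGroup_universal_kernel [OF subgroup_imp_normal [OF assms(2)] this]
  obtain k where k: "k \<in> hom (G Mod H) circle_group"
    "\<And>x. x \<in> carrier G \<Longrightarrow> k (H #> x) = h x" by blast
  have "topspace \<tau> = carrier G" using top by (simp add: group_topology_def)
  \<comment> \<open>Continuity of \<open>k\<close> comes from the universal property of the quotient
    topology, since \<open>k\<close> composed with the projection agrees with
    \<open>h\<close>.\<close>
  then have "continuous_map \<tau> circle_topology (k \<circ> (\<lambda>x. H #> x))"
    using continuous_map_eq [OF cont] k(2) by simp
  then have "continuous_map (coset_topology G \<tau> H) circle_topology k"
    unfolding coset_topology_def
    using continuous_compose_quotient_map [OF quotient_map_quotient_topology] by blast
  then have "k \<in> characters (G Mod H) (coset_topology G \<tau> H)"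
    using k(1) by (simp add: characters_def)
  then have "k (H #> x) = \<one>\<^bsub>circle_group\<^esub>"
    using Q x rcosetsI [OF H.subset x]
    by (auto simp: minimally_almost_periodic_def FactGroup_def)
  then show "h x = \<one>\<^bsub>circle_group\<^esub>" using k(2) x by simp
qed

text \<open>In exponent two \<open>x \<otimes> y\<close> is also the quotient of \<open>x\<close> by
  \<open>y\<close>, so \<open>N (x \<otimes> y)\<close> is an invariant metric. Hypothesis
  \<open>gen\<close> says that no proper subgroup contains a ball around the identity, whereas the
  kernel of a character always does.\<close>

lemma boolean_normed_group_admits:
  fixes G (structure) and N :: "'a \<Rightarrow> real"
  assumes "group G"
    and exp2: "\<And>x. x \<in> carrier G \<Longrightarrow> x \<otimes> x = \<one>"
    and N_one: "N \<one> = 0"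
    and N_pos: "\<And>x. x \<in> carrier G \<Longrightarrow> x \<noteq> \<one> \<Longrightarrow> 0 < N x"
    and N_mult: "\<And>x y. x \<in> carrier G \<Longrightarrow> y \<in> carrier G \<Longrightarrow> N (x \<otimes> y) \<le> N x + N y"
    and gen: "\<And>e K. 0 < e \<Longrightarrow> subgroup K G \<Longrightarrow> {x \<in> carrier G. N x < e} \<subseteq> K \<Longrightarrow> K = carrier G"
  shows "admits_minimally_almost_periodic_Hausdorff G"
proof -
  interpret group G by fact
  interpret C: comm_group circle_group by (rule comm_group_circle_group)
  have inv_id: "inv x = x" if "x \<in> carrier G" for x
    using that exp2 by (simp add: inv_equality)
  have comm: "x \<otimes> y = y \<otimes> x" if "x \<in> carrier G" "y \<in> carrier G" for x y
    using that inv_mult_group [of x y] by (simp add: inv_id)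
  interpret comm_group G by unfold_locales (rule comm)
  \<comment> \<open>The value 0 off the carrier keeps \<open>d\<close> non-negative and symmetric
    for all arguments, as \<open>Metric_space\<close> demands.\<close>
  define d where "d x y = (if x \<in> carrier G \<and> y \<in> carrier G then N (x \<otimes> y) else 0)" for x y
  have N_nonneg: "0 \<le> N x" if "x \<in> carrier G" for x
    using N_pos [OF that] N_one by (cases "x = \<one>") auto
  have eq_iff: "x \<otimes> y = \<one> \<longleftrightarrow> x = y" if "x \<in> carrier G" "y \<in> carrier G" for x y
    using that exp2 inv_equality inv_id by metis
  have cancel: "(x \<otimes> y) \<otimes> (y \<otimes> z) = x \<otimes> z"
    if "x \<in> carrier G" "y \<in> carrier G" "z \<in> carrier G" for x y z
  proof -
    have "(x \<otimes> y) \<otimes> (y \<otimes> z) = x \<otimes> (y \<otimes> y) \<otimes> z"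
      using that by (simp add: m_assoc)
    then show ?thesis using that exp2 by simp
  qed
  interpret M: Metric_space "carrier G" d
  proof
    fix x y z
    show "0 \<le> d x y" by (simp add: d_def N_nonneg)
    show "d x y = d y x" by (simp add: d_def m_comm)
    show "x \<in> carrier G \<Longrightarrow> y \<in> carrier G \<Longrightarrow> (d x y = 0) = (x = y)"
      using N_pos [of "x \<otimes> y"] N_one eq_iff [of x y] by (auto simp: d_def)
    show "x \<in> carrier G \<Longrightarrow> y \<in> carrier G \<Longrightarrow> z \<in> carrier G \<Longrightarrow> d x z \<le> d x y + d y z"
      using N_mult [of "x \<otimes> y" "y \<otimes> z"] by (simp add: d_def cancel)
  qed
  \<comment> \<open>Multiplication does not increase the sum of the distances, which is why balls of
    radius \<open>e/2\<close> suffice below.\<close>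
  have d_mult: "d (x \<otimes> y) (x' \<otimes> y') \<le> d x x' + d y y'"
    if "x \<in> carrier G" "y \<in> carrier G" "x' \<in> carrier G" "y' \<in> carrier G" for x y x' y'
    using that N_mult [of "x \<otimes> x'" "y \<otimes> y'"] by (simp add: d_def m_ac)
  have "continuous_map (prod_topology M.mtopology M.mtopology) M.mtopology (\<lambda>(x, y). x \<otimes> y)"
    unfolding M.continuous_map_to_metric
  proof (intro ballI allI impI)
    fix p and e :: real
    assume p: "p \<in> topspace (prod_topology M.mtopology M.mtopology)" and e: "0 < e"
    obtain x y where xy: "p = (x, y)" "x \<in> carrier G" "y \<in> carrier G" using p by auto
    show "\<exists>U. openin (prod_topology M.mtopology M.mtopology) U \<and> p \<in> U \<and>
        (\<forall>q\<in>U. (case q of (x, y) \<Rightarrow> x \<otimes> y) \<in> M.mball (case p of (x, y) \<Rightarrow> x \<otimes> y) e)"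
    proof (intro exI conjI)
      show "openin (prod_topology M.mtopology M.mtopology)
          (M.mball x (e/2) \<times> M.mball y (e/2))"
        by (simp add: openin_prod_Times_iff)
      show "p \<in> M.mball x (e/2) \<times> M.mball y (e/2)"
        using xy e by simp
      show "\<forall>q\<in>M.mball x (e/2) \<times> M.mball y (e/2).
          (case q of (x, y) \<Rightarrow> x \<otimes> y) \<in> M.mball (case p of (x, y) \<Rightarrow> x \<otimes> y) e"
      proof clarify
        fix x' y' assume "x' \<in> M.mball x (e/2)" "y' \<in> M.mball y (e/2)"
        then show "x' \<otimes> y' \<in> M.mball (case p of (x, y) \<Rightarrow> x \<otimes> y) e"
          using d_mult [of x y x' y'] xy by (simp add: M.in_mball)
      qed
    qed
  qed
  moreover have "continuous_map M.mtopology M.mtopology (\<lambda>x. inv x)"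
    by (rule continuous_map_eq [OF continuous_map_id]) (simp add: inv_id)
  ultimately have top: "group_topology G M.mtopology"
    by (simp add: group_topology_def)
  have "minimally_almost_periodic G M.mtopology"
    unfolding minimally_almost_periodic_def
  proof (intro conjI top ballI)
    fix h x assume h: "h \<in> characters G M.mtopology" and x: "x \<in> carrier G"
    have hom: "h \<in> hom G circle_group" and cont: "continuous_map M.mtopology circle_topology h"
      using h by (auto simp: characters_def)
    interpret h: group_hom G circle_group h
      by unfold_locales (rule hom)
    let ?V = "{x \<in> carrier G. h x \<in> carrier circle_group - {half_turn}}"
    have "openin M.mtopology ?V"
      using openin_continuous_map_preimage [OF cont openin_circle_topology_minus_half_turn] by simp
    moreover have "\<one> \<in> ?V"
      using half_turn_neq_one [symmetric] by simp
    ultimately obtain e where e: "0 < e" "M.mball \<one> e \<subseteq> ?V"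
      unfolding M.openin_mtopology by blast
    have "{x \<in> carrier G. N x < e} \<subseteq> kernel G circle_group h"
    proof clarify
      fix y assume y: "y \<in> carrier G" "N y < e"
      then have "y \<in> M.mball \<one> e" by (simp add: M.in_mball d_def)
      then have "h y \<noteq> half_turn" using e by auto
      \<comment> \<open>The value \<open>h y\<close> squares to the identity, so once
        \<open>half_turn\<close> is excluded it must be trivial.\<close>
      moreover have "h y \<otimes>\<^bsub>circle_group\<^esub> h y = \<one>\<^bsub>circle_group\<^esub>"
        using h.hom_mult [OF y(1) y(1)] by (simp add: exp2 y)
      ultimately show "y \<in> kernel G circle_group h"
        using circle_group_involution [of "h y"] y by (auto simp: kernel_def)
    qed
    from gen [OF e(1) h.subgroup_kernel this]
    show "h x = \<one>\<^bsub>circle_group\<^esub>" using x by (auto simp: kernel_def)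
  qed
  then show ?thesis
    using M.Hausdorff_space_mtopology by (auto simp: admits_minimally_almost_periodic_Hausdorff_def)
qed

text \<open>The topology pulled back along \<open>f\<close> turns \<open>f\<close> into an
  isomorphism of topological groups. Characters of \<open>G\<close> then become characters of
  \<open>H\<close> by composition with the inverse of \<open>f\<close>.\<close>

lemma admits_minimally_almost_periodic_Hausdorff_iso:
  assumes "group G" and "group H" and f: "f \<in> iso G H"
    and "admits_minimally_almost_periodic_Hausdorff H"
  shows "admits_minimally_almost_periodic_Hausdorff G"
proof -
  interpret G: group G by fact
  interpret H: group H by fact
  interpret f: group_hom G H f
    using f by unfold_locales (simp add: iso_def)
  obtain \<tau> where haus: "Hausdorff_space \<tau>" and map: "minimally_almost_periodic H \<tau>"
    using assms(4) by (auto simp: admits_minimally_almost_periodic_Hausdorff_def)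
  have top: "topspace \<tau> = carrier H"
    and mult: "continuous_map (prod_topology \<tau> \<tau>) \<tau> (\<lambda>(x, y). x \<otimes>\<^bsub>H\<^esub> y)"
    and inv: "continuous_map \<tau> \<tau> (\<lambda>x. inv\<^bsub>H\<^esub> x)"
    using map by (auto simp: minimally_almost_periodic_def group_topology_def)
  define \<sigma> where "\<sigma> = pullback_topology (carrier G) f \<tau>"
  have top': "topspace \<sigma> = carrier G"
    by (auto simp: \<sigma>_def topspace_pullback_topology top)
  have f_cont: "continuous_map \<sigma> \<tau> f"
    using continuous_map_pullback [OF continuous_map_id [of \<tau>]] by (simp add: \<sigma>_def)
  have f_bij: "bij_betw f (carrier G) (carrier H)"
    using f by (simp add: iso_def)
  have "Hausdorff_space \<sigma>"
    using Hausdorff_space_injective_preimage [OF haus f_cont] f_bij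
    by (simp add: top' bij_betw_def)
  moreover have "group_topology G \<sigma>"
    unfolding group_topology_def
  proof (intro conjI top')
    \<comment> \<open>A map into a pullback topology is continuous once its composite with
      \<open>f\<close> is; since \<open>f\<close> is a homomorphism, that composite is
      multiplication in \<open>H\<close> after \<open>f\<close> on both factors.\<close>
    have "continuous_map (prod_topology \<sigma> \<sigma>) (prod_topology \<tau> \<tau>) (\<lambda>(x, y). (f x, f y))"
      by (simp add: continuous_map_prod_top f_cont)
    from continuous_map_compose [OF this mult]
    have "continuous_map (prod_topology \<sigma> \<sigma>) \<tau> (f \<circ> (\<lambda>(x, y). x \<otimes>\<^bsub>G\<^esub> y))"
      by (rule continuous_map_eq) (auto simp: top')
    then show "continuous_map (prod_topology \<sigma> \<sigma>) \<sigma> (\<lambda>(x, y). x \<otimes>\<^bsub>G\<^esub> y)"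
      unfolding \<sigma>_def by (rule continuous_map_pullback') (auto simp: top' simp flip: \<sigma>_def)
    from continuous_map_compose [OF f_cont inv]
    have "continuous_map \<sigma> \<tau> (f \<circ> (\<lambda>x. inv\<^bsub>G\<^esub> x))"
      by (rule continuous_map_eq) (auto simp: top')
    then show "continuous_map \<sigma> \<sigma> (\<lambda>x. inv\<^bsub>G\<^esub> x)"
      using continuous_map_pullback' [of \<sigma> \<tau> f "\<lambda>x. inv\<^bsub>G\<^esub> x" "carrier G"]
      by (auto simp: top' simp flip: \<sigma>_def)
  qed
  moreover have "h x = \<one>\<^bsub>circle_group\<^esub>" if h: "h \<in> characters G \<sigma>" and x: "x \<in> carrier G" for h x
  proof -
    define g where "g = inv_into (carrier G) f"
    have g: "g \<in> iso H G"
      using G.iso_set_sym [OF f] by (simp add: g_def)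
    have fg: "f (g y) = y" if "y \<in> carrier H" for y
      using that f_bij by (simp add: g_def bij_betw_def f_inv_into_f)
    \<comment> \<open>\<open>f \<circ> g\<close> is the identity on the carrier of \<open>H\<close>,
      so \<open>g\<close> is continuous into the pullback topology.\<close>
    have "continuous_map \<tau> \<tau> (f \<circ> g)"
      by (rule continuous_map_eq [OF continuous_map_id]) (simp add: top fg)
    moreover have "g \<in> carrier H \<rightarrow> carrier G"
      using g by (auto simp: iso_def hom_def)
    ultimately have "continuous_map \<tau> \<sigma> g"
      using continuous_map_pullback' [of \<tau> \<tau> f g "carrier G"] by (auto simp: \<sigma>_def top)
    then have "h \<circ> g \<in> characters H \<tau>"
      using h g by (auto simp: characters_def iso_def intro: hom_compose continuous_map_compose)
    then have "h (g (f x)) = \<one>\<^bsub>circle_group\<^esub>"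
      using map x by (auto simp: minimally_almost_periodic_def)
    then show ?thesis
      using x f_bij by (simp add: g_def bij_betw_def inv_into_f_f)
  qed
  ultimately show ?thesis
    by (auto simp: admits_minimally_almost_periodic_Hausdorff_def minimally_almost_periodic_def)
qed

section \<open>Periodic sets and their density\<close>

text \<open>Here \<open>m\<close> is any period, not the least one. Positivity excludes
  \<open>m = 0\<close>, where \<open>n mod 0 = n\<close> would admit every set.\<close>

definition periodic_set :: "nat \<Rightarrow> nat set \<Rightarrow> bool" where
  "periodic_set m A \<longleftrightarrow> 0 < m \<and> (\<forall>n. n mod m \<in> A \<longleftrightarrow> n \<in> A)"

lemma periodic_set_mult:
  assumes "periodic_set m A" "0 < k"
  shows "periodic_set (m * k) A"
proof -
  have "n mod (m * k) \<in> A \<longleftrightarrow> n \<in> A" for n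
  proof -
    have "n mod (m * k) \<in> A \<longleftrightarrow> n mod (m * k) mod m \<in> A"
      using assms(1) by (simp add: periodic_set_def)
    also have "\<dots> \<longleftrightarrow> n \<in> A"
      using assms(1) by (simp add: periodic_set_def mod_mod_cancel)
    finally show ?thesis .
  qed
  then show ?thesis using assms by (simp add: periodic_set_def)
qed

lemma periodic_set_common:
  assumes "periodic_set m A" "periodic_set k B"
  shows "periodic_set (m * k) A" "periodic_set (m * k) B"
  using periodic_set_mult [OF assms(1), of k] periodic_set_mult [OF assms(2), of m] assms
  by (simp_all add: periodic_set_def mult.commute)

lemma periodic_set_sym_diff:
  "periodic_set m A \<Longrightarrow> periodic_set m B \<Longrightarrow> periodic_set m (sym_diff A B)"
  by (simp add: periodic_set_def)

text \<open>Each block of length \<open>m\<close> starting at a multiple of \<open>m\<close>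
  contains a translate of the trace of \<open>A\<close> on the first block; the induction adds one
  block at a time.\<close>

lemma card_periodic_set:
  assumes "periodic_set m A"
  shows "card (A \<inter> {..<m * k}) = k * card (A \<inter> {..<m})"
proof (induction k)
  case (Suc k)
  have mem: "m * k + i \<in> A \<longleftrightarrow> i \<in> A" for i
    using assms unfolding periodic_set_def by (metis mod_mult_self4 mult.commute)
  have "A \<inter> {m * k..<m * Suc k} = (\<lambda>i. m * k + i) ` (A \<inter> {..<m})"
  proof (intro equalityI subsetI)
    fix n assume n: "n \<in> A \<inter> {m * k..<m * Suc k}"
    then have "n = m * k + (n - m * k)" by simp
    moreover have "n - m * k \<in> A \<inter> {..<m}"
      using n mem [of "n - m * k"] by auto
    ultimately show "n \<in> (\<lambda>i. m * k + i) ` (A \<inter> {..<m})" by blast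
  qed (auto simp: mem)
  then have "card (A \<inter> {m * k..<m * Suc k}) = card (A \<inter> {..<m})"
    by (simp add: card_image)
  moreover have "A \<inter> {..<m * Suc k} = (A \<inter> {..<m * k}) \<union> (A \<inter> {m * k..<m * Suc k})"
    by auto
  ultimately show ?case
    using Suc card_Un_disjoint [of "A \<inter> {..<m * k}" "A \<inter> {m * k..<m * Suc k}"] by fastforce
qed simp

text \<open>Natural density, read off one period; \<open>periodic_density_eq\<close> shows that
  every period gives the same value.\<close>

definition periodic_density :: "nat set \<Rightarrow> real" where
  "periodic_density A = (let m = (SOME m. periodic_set m A) in card (A \<inter> {..<m}) / m)"

lemma periodic_density_eq:
  assumes "periodic_set m A"
  shows "periodic_density A = card (A \<inter> {..<m}) / m"
proof -
  define p where "p = (SOME m. periodic_set m A)"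
  have p: "periodic_set p A"
    using assms unfolding p_def by (rule someI)
  \<comment> \<open>Double counting: the part of \<open>A\<close> below \<open>m * p\<close> is cut
    into blocks of length \<open>m\<close> and into blocks of length \<open>p\<close>.\<close>
  have "p * card (A \<inter> {..<m}) = m * card (A \<inter> {..<p})"
    using card_periodic_set [OF assms, of p] card_periodic_set [OF p, of m]
    by (simp add: mult.commute)
  then have "real p * card (A \<inter> {..<m}) = real m * card (A \<inter> {..<p})"
    by (metis of_nat_mult)
  moreover have "0 < m" "0 < p" using assms p by (auto simp: periodic_set_def)
  ultimately show ?thesis
    by (simp add: periodic_density_def Let_def field_simps flip: p_def)
qed

lemma periodic_density_pos:
  assumes "periodic_set m A" "A \<noteq> {}"
  shows "0 < periodic_density A"
proof -
  obtain n where "n \<in> A" using assms(2) by blast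
  then have "n mod m \<in> A \<inter> {..<m}" using assms(1) by (simp add: periodic_set_def)
  then have "0 < card (A \<inter> {..<m})" by (auto simp: card_gt_0_iff)
  then show ?thesis using assms(1) by (simp add: periodic_density_eq periodic_set_def)
qed

lemma periodic_density_sym_diff:
  assumes "periodic_set m A" "periodic_set k B"
  shows "periodic_density (sym_diff A B) \<le> periodic_density A + periodic_density B"
proof -
  note per = periodic_set_common [OF assms]
  have "card (sym_diff A B \<inter> {..<m * k}) \<le> card ((A \<inter> {..<m * k}) \<union> (B \<inter> {..<m * k}))"
    by (rule card_mono) auto
  also have "\<dots> \<le> card (A \<inter> {..<m * k}) + card (B \<inter> {..<m * k})"
    by (rule card_Un_le)
  finally show ?thesis
    unfolding periodic_density_eq [OF per(1)] periodic_density_eq [OF per(2)]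
      periodic_density_eq [OF periodic_set_sym_diff [OF per]]
    by (simp add: divide_right_mono flip: add_divide_distrib of_nat_add)
qed

lemma periodic_set_residue_class: "periodic_set m A \<Longrightarrow> periodic_set m (A \<inter> {n. n mod m = r})"
  by (simp add: periodic_set_def)

text \<open>Within one period the residue class contains at most the point \<open>r\<close>. Larger
  periods thus give pieces of arbitrarily small density.\<close>

lemma periodic_density_residue_class:
  assumes "periodic_set m A"
  shows "periodic_density (A \<inter> {n. n mod m = r}) \<le> 1 / m"
proof -
  have "card (A \<inter> {n. n mod m = r} \<inter> {..<m}) \<le> card {r}"
    by (rule card_mono) auto
  then show ?thesis
    unfolding periodic_density_eq [OF periodic_set_residue_class [OF assms]]
    by (intro divide_right_mono) auto
qed

section \<open>The Boolean group of periodic sets\<close>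

text \<open>Abstractly a vector space of countably infinite dimension over the field with two
  elements; realizing it by sets makes density available as a norm.\<close>

definition periodic_group :: "nat set monoid" where
  "periodic_group = \<lparr>carrier = {A. \<exists>m. periodic_set m A}, mult = sym_diff, one = {}\<rparr>"

lemma sym_diff_closed:
  "A \<in> carrier periodic_group \<Longrightarrow> B \<in> carrier periodic_group \<Longrightarrow>
   sym_diff A B \<in> carrier periodic_group"
  using periodic_set_sym_diff [OF periodic_set_common]
  unfolding periodic_group_def partial_object.simps mem_Collect_eq by blast

lemma empty_periodic: "{} \<in> carrier periodic_group"
  and UNIV_periodic: "UNIV \<in> carrier periodic_group"
  by (auto simp: periodic_group_def periodic_set_def)

lemma comm_group_periodic_group: "comm_group periodic_group"
proof (rule comm_groupI)
  fix A assume "A \<in> carrier periodic_group"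
  then show "\<exists>B\<in>carrier periodic_group. B \<otimes>\<^bsub>periodic_group\<^esub> A = \<one>\<^bsub>periodic_group\<^esub>"
    by (intro bexI [of _ A]) (auto simp: periodic_group_def)
qed (use sym_diff_closed empty_periodic in \<open>auto simp: periodic_group_def\<close>)

lemma countable_periodic_group: "countable (carrier periodic_group)"
proof -
  \<comment> \<open>A periodic set is coded by a period and its finite trace below that
    period.\<close>
  have "carrier periodic_group \<subseteq> (\<lambda>(m, F). {n. n mod m \<in> F}) ` (UNIV \<times> Collect finite)"
  proof
    fix A assume "A \<in> carrier periodic_group"
    then obtain m where "periodic_set m A" by (auto simp: periodic_group_def)
    then have "A = (\<lambda>(m, F). {n. n mod m \<in> F}) (m, A \<inter> {..<m})"
      by (auto simp: periodic_set_def)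
    then show "A \<in> (\<lambda>(m, F). {n. n mod m \<in> F}) ` (UNIV \<times> Collect finite)"
      by (rule image_eqI) simp
  qed
  then show ?thesis
    by (rule countable_subset) (intro countable_image countable_SIGMA countable_Collect_finite, auto)
qed

lemma admits_periodic_group: "admits_minimally_almost_periodic_Hausdorff periodic_group"
proof -
  interpret comm_group periodic_group by (rule comm_group_periodic_group)
  show ?thesis
  proof (rule boolean_normed_group_admits [where N = periodic_density])
    show "periodic_density \<one>\<^bsub>periodic_group\<^esub> = 0"
      using periodic_density_eq [of 1 "{}"] by (simp add: periodic_group_def periodic_set_def)
  next
    fix e :: real and K
    assume e: "0 < e" and K: "subgroup K periodic_group"
      and small: "{A \<in> carrier periodic_group. periodic_density A < e} \<subseteq> K"
    interpret K: subgroup K periodic_group by fact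
    show "K = carrier periodic_group"
    proof
      show "K \<subseteq> carrier periodic_group" by (rule K.subset)
      show "carrier periodic_group \<subseteq> K"
      proof
        fix A assume "A \<in> carrier periodic_group"
        then obtain m where m: "periodic_set m A" by (auto simp: periodic_group_def)
        obtain k where k: "1 / real (Suc k) < e"
          using e reals_Archimedean by (auto simp: inverse_eq_divide)
        \<comment> \<open>A multiple of the period \<open>m\<close> is again a period, and
          \<open>p \<ge> Suc k\<close> since \<open>m\<close> is positive; hence each residue class
          of \<open>A\<close> modulo \<open>p\<close> has density below \<open>e\<close>.\<close>
        define p where "p = m * Suc k"
        have p: "periodic_set p A" unfolding p_def by (rule periodic_set_mult [OF m]) simp
        have "Suc k \<le> p" using m by (cases m) (simp_all add: p_def periodic_set_def)
        then have "1 / real p \<le> 1 / real (Suc k)" by (intro divide_left_mono) auto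
        with k have "1 / real p < e" by linarith
        then have res: "A \<inter> {n. n mod p = r} \<in> K" for r
          using periodic_density_residue_class [OF p, of r] periodic_set_residue_class [OF p, of r] small
          by (force simp: periodic_group_def)
        \<comment> \<open>The residue classes are added one by one. They are disjoint, so symmetric
          difference acts as union, and at \<open>r = p\<close> all of \<open>A\<close> is
          reached.\<close>
        have "A \<inter> {n. n mod p < r} \<in> K" for r
        proof (induction r)
          case 0
          then show ?case using K.one_closed by (simp add: periodic_group_def)
        next
          case (Suc r)
          have "A \<inter> {n. n mod p < Suc r} =
              (A \<inter> {n. n mod p < r}) \<otimes>\<^bsub>periodic_group\<^esub> (A \<inter> {n. n mod p = r})"
            by (auto simp: periodic_group_def)
          then show ?case using K.m_closed [OF Suc res] by simp
        qed
        from this [of p] show "A \<in> K" using p by (simp add: periodic_set_def)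
      qed
    qed
  qed (use is_group periodic_density_pos periodic_density_sym_diff in \<open>auto simp: periodic_group_def\<close>)
qed

section \<open>The twisted extension\<close>

text \<open>An extension of \<^const>\<open>periodic_group\<close> by itself whose cocycle makes \<open>({}, UNIV)\<close>
  the only non-trivial square.\<close>

definition twisted_group :: "(nat set \<times> nat set) monoid" where
  "twisted_group =
    \<lparr>carrier = carrier periodic_group \<times> carrier periodic_group,
     mult = (\<lambda>(A, B) (A', B').
       (sym_diff A A', sym_diff (sym_diff B B') (if 0 \<in> A \<inter> A' then UNIV else {}))),
     one = ({}, {})\<rparr>"

text \<open>The cocycle is the product of the bits \<open>0 \<in> A\<close> and
  \<open>0 \<in> A'\<close>, and these bits are additive modulo two under symmetric difference.
  Biadditivity gives associativity, symmetry gives commutativity.\<close>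

lemma comm_group_twisted_group: "comm_group twisted_group"
proof (rule comm_groupI)
  fix x y assume "x \<in> carrier twisted_group" "y \<in> carrier twisted_group"
  then show "x \<otimes>\<^bsub>twisted_group\<^esub> y \<in> carrier twisted_group"
    by (auto simp only: twisted_group_def monoid.simps partial_object.simps case_prod_conv mem_Times_iff
        fst_conv snd_conv intro!: sym_diff_closed split: if_splits prod.splits
        intro: empty_periodic UNIV_periodic)
next
  fix x assume x: "x \<in> carrier twisted_group"
  obtain A B where AB: "x = (A, B)" by force
  \<comment> \<open>When \<open>0 \<in> A\<close>, the square of \<open>x\<close> is
    \<open>({}, UNIV)\<close>, so the inverse is \<open>x\<close> with its second component
    complemented; otherwise \<open>x\<close> is its own inverse.\<close>
  define y where "y = (A, sym_diff B (if 0 \<in> A then UNIV else {}))"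
  have "y \<in> carrier twisted_group"
    using x sym_diff_closed [OF _ UNIV_periodic, of B] sym_diff_closed [OF _ empty_periodic, of B]
    by (auto simp: y_def AB twisted_group_def)
  moreover have "y \<otimes>\<^bsub>twisted_group\<^esub> x = \<one>\<^bsub>twisted_group\<^esub>"
    by (auto simp: y_def AB twisted_group_def)
  ultimately show "\<exists>y\<in>carrier twisted_group. y \<otimes>\<^bsub>twisted_group\<^esub> x = \<one>\<^bsub>twisted_group\<^esub>" ..
next
  fix x y z :: "nat set \<times> nat set"
  show "x \<otimes>\<^bsub>twisted_group\<^esub> y \<otimes>\<^bsub>twisted_group\<^esub> z =
      x \<otimes>\<^bsub>twisted_group\<^esub> (y \<otimes>\<^bsub>twisted_group\<^esub> z)"
    by (cases x; cases y; cases z) (auto simp: twisted_group_def)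
  show "x \<otimes>\<^bsub>twisted_group\<^esub> y = y \<otimes>\<^bsub>twisted_group\<^esub> x"
    by (cases x; cases y) (auto simp: twisted_group_def)
qed (auto simp: twisted_group_def empty_periodic)

section \<open>Coding on the naturals and assembly of the example\<close>

text \<open>The required group has natural numbers as elements, so the operation is transported
  along an injective coding \<open>c\<close> with decoder \<open>d\<close>.\<close>

lemma countable_group_copy:
  fixes P :: "('a, 'b) monoid_scheme"
  assumes "comm_group P" "countable (carrier P)"
  obtains G :: "nat monoid" and f where "comm_group G" "f \<in> iso G P"
proof -
  interpret P: comm_group P by fact
  define c where "c = to_nat_on (carrier P)"
  define d where "d = from_nat_into (carrier P)"
  have dc [simp]: "d (c x) = x" if "x \<in> carrier P" for x
    using that assms(2) by (simp add: c_def d_def)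
  define G where "G = \<lparr>carrier = c ` carrier P,
    mult = (\<lambda>x y. c (d x \<otimes>\<^bsub>P\<^esub> d y)), one = c \<one>\<^bsub>P\<^esub>\<rparr>"
  have "monoid G"
    by (rule monoidI) (auto simp: G_def P.m_assoc)
  moreover have c: "c \<in> iso P G"
    using assms(2) by (auto simp: iso_def hom_def bij_betw_def G_def c_def)
      (simp_all flip: c_def)
  ultimately have "comm_group G"
    using P.iso_imp_comm_group by (auto simp: is_iso_def)
  then show thesis using that P.iso_set_sym [OF c] by blast
qed

theorem theorem3p4:
  shows "\<exists>(G :: nat monoid) H.
    comm_group G \<and> countable (carrier G) \<and> subgroup H G \<and>
    \<not> admits_minimally_almost_periodic_Hausdorff G \<and>
    (G Mod H \<cong> G\<lparr>carrier := H\<rparr> \<and>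
     admits_minimally_almost_periodic_Hausdorff (G\<lparr>carrier := H\<rparr>) \<and>
     admits_minimally_almost_periodic_Hausdorff (G Mod H)) \<and>
    \<not> (\<exists>\<tau>. group_topology G \<tau> \<and> Hausdorff_space \<tau> \<and>
         minimally_almost_periodic (G\<lparr>carrier := H\<rparr>) (subtopology \<tau> H) \<and>
         minimally_almost_periodic (G Mod H) (coset_topology G \<tau> H))"
proof -
  interpret B: comm_group periodic_group by (rule comm_group_periodic_group)
  have "countable (carrier twisted_group)"
    by (simp add: twisted_group_def countable_periodic_group)
  from countable_group_copy [OF comm_group_twisted_group this]
  obtain G :: "nat monoid" and f where G: "comm_group G" and f: "f \<in> iso G twisted_group" .
  interpret G: comm_group G by fact
  interpret T: comm_group twisted_group by (rule comm_group_twisted_group)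
  have f_hom: "f \<in> hom G twisted_group" and f_bij: "bij_betw f (carrier G) (carrier twisted_group)"
    using f by (auto simp: iso_def)
  interpret f: group_hom G twisted_group f
    by unfold_locales (rule f_hom)
  have inj: "x = y" if "x \<in> carrier G" "y \<in> carrier G" "f x = f y" for x y
    using that f_bij by (auto simp: bij_betw_def inj_on_def)
  have surj: "f ` carrier G = carrier twisted_group"
    using f_bij by (simp add: bij_betw_def)
  \<comment> \<open>The cocycle alters only the second component, so the first projection is a
    homomorphism; its kernel in \<open>G\<close> will be \<open>H\<close>.\<close>
  have "fst \<in> hom twisted_group periodic_group"
    by (auto simp: hom_def twisted_group_def periodic_group_def)
  then have q_hom: "fst \<circ> f \<in> hom G periodic_group"
    by (rule hom_compose [OF f_hom])
  interpret q: group_hom G periodic_group "fst \<circ> f"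
    by unfold_locales (rule q_hom)
  define H where "H = kernel G periodic_group (fst \<circ> f)"
  have sub: "subgroup H G" unfolding H_def by (rule q.subgroup_kernel)
  have "(fst \<circ> f) ` carrier G = carrier periodic_group"
    unfolding image_comp [symmetric] surj by (auto simp: twisted_group_def empty_periodic image_iff)
  from q.FactGroup_iso [OF this]
  have quot: "G Mod H \<cong> periodic_group" by (simp add: H_def)
  have memH: "x \<in> H \<longleftrightarrow> x \<in> carrier G \<and> fst (f x) = {}" for x
    by (simp add: H_def kernel_def periodic_group_def)
  \<comment> \<open>On \<open>H\<close> the first components are empty, so the cocycle vanishes and
    the second projection becomes an isomorphism.\<close>
  have "snd \<circ> f \<in> iso (G\<lparr>carrier := H\<rparr>) periodic_group"
  proof (rule isoI)
    show "snd \<circ> f \<in> hom (G\<lparr>carrier := H\<rparr>) periodic_group"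
    proof (rule homI)
      fix x assume "x \<in> carrier (G\<lparr>carrier := H\<rparr>)"
      then have "f x \<in> carrier twisted_group" by (simp add: memH)
      then show "(snd \<circ> f) x \<in> carrier periodic_group" by (auto simp: twisted_group_def)
    next
      fix x y assume "x \<in> carrier (G\<lparr>carrier := H\<rparr>)" "y \<in> carrier (G\<lparr>carrier := H\<rparr>)"
      then show "(snd \<circ> f) (x \<otimes>\<^bsub>G\<lparr>carrier := H\<rparr>\<^esub> y) =
          (snd \<circ> f) x \<otimes>\<^bsub>periodic_group\<^esub> (snd \<circ> f) y"
        by (cases "f x"; cases "f y") (simp add: memH twisted_group_def periodic_group_def)
    qed
    show "bij_betw (snd \<circ> f) (carrier (G\<lparr>carrier := H\<rparr>)) (carrier periodic_group)"
      unfolding bij_betw_def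
    proof
      show "inj_on (snd \<circ> f) (carrier (G\<lparr>carrier := H\<rparr>))"
        by (auto simp: inj_on_def memH intro!: inj prod_eqI)
      have "B \<in> (snd \<circ> f) ` H" if "B \<in> carrier periodic_group" for B
      proof -
        have "({}, B) \<in> f ` carrier G"
          using that by (simp add: surj twisted_group_def empty_periodic)
        then obtain x where "x \<in> carrier G" "f x = ({}, B)" by force
        then show ?thesis by (force simp: memH)
      qed
      moreover have "snd (f x) \<in> carrier periodic_group" if "x \<in> H" for x
        using that f.hom_closed [of x] by (auto simp: memH twisted_group_def)
      ultimately show "(snd \<circ> f) ` carrier (G\<lparr>carrier := H\<rparr>) = carrier periodic_group"
        by auto
    qed
  qed
  then have subiso: "G\<lparr>carrier := H\<rparr> \<cong> periodic_group" by (rule is_isoI)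
  have grpH: "group (G\<lparr>carrier := H\<rparr>)"
    by (rule G.subgroup_imp_group [OF sub])
  have grpQ: "group (G Mod H)"
    using G.abelian_FactGroup [OF sub] by (simp add: comm_group_def)
  have admH: "admits_minimally_almost_periodic_Hausdorff (G\<lparr>carrier := H\<rparr>)"
    using subiso admits_minimally_almost_periodic_Hausdorff_iso
      [OF grpH B.is_group _ admits_periodic_group] by (auto simp: is_iso_def)
  have admQ: "admits_minimally_almost_periodic_Hausdorff (G Mod H)"
    using quot admits_minimally_almost_periodic_Hausdorff_iso
      [OF grpQ B.is_group _ admits_periodic_group] by (auto simp: is_iso_def)
  have iso: "G Mod H \<cong> G\<lparr>carrier := H\<rparr>"
    using quot group.iso_sym [OF grpH subiso] by (rule iso_trans)
  have el: "\<exists>x\<in>carrier G. f x = p" if "p \<in> carrier twisted_group" for p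
    using that surj by (metis imageE)
  obtain a where a: "a \<in> carrier G" "f a = ({}, UNIV)"
    using el [of "({}, UNIV)"] by (auto simp: twisted_group_def empty_periodic UNIV_periodic)
  \<comment> \<open>Since \<open>0 \<in> UNIV\<close>, the cocycle contributes \<open>UNIV\<close>
    to the square of \<open>g\<close>, which is therefore non-trivial.\<close>
  obtain g where g: "g \<in> carrier G" "f g = (UNIV, {})"
    using el [of "(UNIV, {})"] by (auto simp: twisted_group_def empty_periodic UNIV_periodic)
  have sq: "f (x \<otimes>\<^bsub>G\<^esub> x) = ({}, if 0 \<in> fst (f x) then UNIV else {})" if "x \<in> carrier G" for x
    using that by (cases "f x") (simp add: twisted_group_def)
  have f_one: "f \<one>\<^bsub>G\<^esub> = ({}, {})"
    using f.hom_one by (simp add: twisted_group_def)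
  have not_adm: "\<not> admits_minimally_almost_periodic_Hausdorff G"
  proof (rule not_admits_if_single_square [OF G _ g(1)])
    fix x assume x: "x \<in> carrier G"
    then have "f (x \<otimes>\<^bsub>G\<^esub> x) = f \<one>\<^bsub>G\<^esub> \<or> f (x \<otimes>\<^bsub>G\<^esub> x) = f a"
      unfolding sq [OF x] f_one a by simp
    then show "x \<otimes>\<^bsub>G\<^esub> x \<in> {\<one>\<^bsub>G\<^esub>, a}"
      using x a(1) inj by auto
  next
    show "g \<otimes>\<^bsub>G\<^esub> g \<noteq> \<one>\<^bsub>G\<^esub>"
      using sq [OF g(1)] f_one g(2) by auto
  qed
  \<comment> \<open>By the extension lemma such a topology would be Hausdorff and minimally almost
    periodic on \<open>G\<close>, contradicting \<open>not_adm\<close>.\<close>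
  moreover have "\<not> (\<exists>\<tau>. group_topology G \<tau> \<and> Hausdorff_space \<tau> \<and>
         minimally_almost_periodic (G\<lparr>carrier := H\<rparr>) (subtopology \<tau> H) \<and>
         minimally_almost_periodic (G Mod H) (coset_topology G \<tau> H))"
    using not_adm minimally_almost_periodic_extension [OF G sub]
    by (auto simp: admits_minimally_almost_periodic_Hausdorff_def)
  ultimately show ?thesis
    using G sub iso admH admQ by blast
qed

end
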